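(* Let $R=\{(0,0),(0,1),(0,3),(2,0),(1,1),(1,3),(2,1),(2,2),(2,3),(3,3)\}$ and $R'=\{(0,0),(1,0),(3,0),(0,2),(1,1),(1,2),(3,1),(2,2),(3,2),(3,3)\}$. Then $(123,R)\sim_{jd}(132,R)$ and $(123,R')\sim_{jd}(132,R')$.
   Context: $S_n$ is the set of permutations $\pi=\pi_1\cdots\pi_n$ of $\{1,\dots,n\}$. A mesh pattern of length $k$ is a pair $(\tau,R)$ with $\tau\in S_k$ and $R\subseteq\{0,\dots,k\}\times\{0,\dots,k\}$ (the set of shaded boxes; box $(a,b)$ is the unit square with lower-left corner $(a,b)$). An occurrence of $(\tau,R)$ in $\pi\in S_n$ is a subsequence $\pi_{i_1}\cdots\pi_{i_k}$, $i_1<\dots<i_k$, order-isomorphic to $\tau$, such that, with $i_0=0$, $i_{k+1}=n+1$, with $v_1<\dots<v_k$ the values $\pi_{i_1},\dots,\pi_{i_k}$ in increasing order, and $v_0=0$, $v_{k+1}=n+1$, for each $(a,b)\in R$ there is no index $m$ with $i_a<m<i_{a+1}$ and $v_b<\pi_m<v_{b+1}$. Two mesh patterns $q_1,q_2$ are jointly equidistributed, written $q_1\sim_{jd}q_2$, if for all nonnegative integers $n,k,\ell$ the number of $\pi\in S_n$ with exactly $k$ occurrences of $q_1$ and $\ell$ occurrences of $q_2$ equals the number of $\pi\in S_n$ with exactly $\ell$ occurrences of $q_1$ and $k$ occurrences of $q_2$. *)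

theory Defs
  imports "HOL-Combinatorics.Combinatorics"
begin

(* S_n, in one-line notation: \<pi> = [\<pi>_1, ..., \<pi>_n].  The one-based entry \<pi>_m
   is therefore the list element \<pi> ! (m - 1). *)
definition Sn :: "nat \<Rightarrow> nat list set" where
  "Sn n = permutations_of_set {1..n}"

definition entry :: "nat list \<Rightarrow> nat \<Rightarrow> nat" where
  "entry \<pi> m = \<pi> ! (m - 1)"

type_synonym mesh = "nat list \<times> (nat \<times> nat) set"

definition is_mesh_pattern :: "mesh \<Rightarrow> bool" where
  "is_mesh_pattern q \<longleftrightarrow> (case q of (\<tau>, R) \<Rightarrow>
     \<tau> \<in> Sn (length \<tau>) \<and> R \<subseteq> {0..length \<tau>} \<times> {0..length \<tau>})"

definition order_isomorphic :: "nat list \<Rightarrow> nat list \<Rightarrow> bool" where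
  "order_isomorphic xs ys \<longleftrightarrow> length xs = length ys \<and>
     (\<forall>a < length xs. \<forall>b < length xs. (xs ! a < xs ! b \<longleftrightarrow> ys ! a < ys ! b))"

(* An occurrence is given by its list of positions ps = [i_1, ..., i_k].  The lists
   bd n ps and bd n (sort ...) are (i_0, ..., i_{k+1}) and (v_0, ..., v_{k+1}). *)
definition bd :: "nat \<Rightarrow> nat list \<Rightarrow> nat list" where
  "bd n xs = 0 # xs @ [n + 1]"

definition is_occurrence :: "mesh \<Rightarrow> nat list \<Rightarrow> nat list \<Rightarrow> bool" where
  "is_occurrence q \<pi> ps \<longleftrightarrow> (case q of (\<tau>, R) \<Rightarrow>
     let n = length \<pi>; w = map (entry \<pi>) ps; i = bd n ps; v = bd n (sort w) in
       sorted_wrt (<) ps \<and> set ps \<subseteq> {1..n} \<and> order_isomorphic w \<tau> \<and>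
       (\<forall>(a, b) \<in> R. \<not> (\<exists>m \<in> {1..n}.
          i ! a < m \<and> m < i ! (a + 1) \<and> v ! b < entry \<pi> m \<and> entry \<pi> m < v ! (b + 1))))"

definition occurrences :: "mesh \<Rightarrow> nat list \<Rightarrow> nat" where
  "occurrences q \<pi> = card {ps. is_occurrence q \<pi> ps}"

definition jointly_equidistributed :: "mesh \<Rightarrow> mesh \<Rightarrow> bool"  (infix "\<sim>jd" 50) where
  "q1 \<sim>jd q2 \<longleftrightarrow> (\<forall>n k l.
     card {\<pi> \<in> Sn n. occurrences q1 \<pi> = k \<and> occurrences q2 \<pi> = l} =
     card {\<pi> \<in> Sn n. occurrences q1 \<pi> = l \<and> occurrences q2 \<pi> = k})"

definition R1 :: "(nat \<times> nat) set" where
  "R1 = {(0,0),(0,1),(0,3),(2,0),(1,1),(1,3),(2,1),(2,2),(2,3),(3,3)}"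

definition R2 :: "(nat \<times> nat) set" where
  "R2 = {(0,0),(1,0),(3,0),(0,2),(1,1),(1,2),(3,1),(2,2),(3,2),(3,3)}"

lemma is_mesh_pattern_examples:
  "is_mesh_pattern ([1,2,3], R1)" "is_mesh_pattern ([1,3,2], R1)"
  "is_mesh_pattern ([1,2,3], R2)" "is_mesh_pattern ([1,3,2], R2)"
  by (auto simp: is_mesh_pattern_def Sn_def permutations_of_set_def R1_def R2_def)

(* card in the definition of occurrences is never applied to an infinite set. *)
lemma finite_occurrences: "finite {ps. is_occurrence q \<pi> ps}"
proof (rule finite_subset)
  show "{ps. is_occurrence q \<pi> ps} \<subseteq> {ps. set ps \<subseteq> {1..length \<pi>} \<and> length ps = length (fst q)}"
    by (cases q) (fastforce simp: is_occurrence_def order_isomorphic_def Let_def)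
  show "finite {ps. set ps \<subseteq> {1..length \<pi>} \<and> length ps = length (fst q)}"
    by (rule finite_lists_length_eq) simp
qed

end

theory Submission
  imports Defs
begin

text \<open>Exchanging the entries at positions \<open>j\<close> and \<open>k\<close> turns an occurrence \<open>[i, j, k]\<close> of
  \<open>(123, R)\<close> into an occurrence of \<open>(132, R)\<close> at the same positions and vice versa, whatever the
  shading \<open>R\<close>: the grid lines and all points off the grid lines stay put. Hence both patterns have
  the same total number of occurrences over \<open>S\<^sub>n\<close>. For the two given shadings every permutation
  contains each pattern at most once, and two \<open>{0,1}\<close>-valued statistics with the same total are
  automatically jointly equidistributed.\<close>

section \<open>Zero-one statistics with equal totals\<close>

text \<open>Writing \<open>N a b\<close> for the size of a joint fibre, the totals are
  \<open>N 1 0 + N 1 1\<close> and \<open>N 0 1 + N 1 1\<close>. Cancelling \<open>N 1 1\<close>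
  gives \<open>N 1 0 = N 0 1\<close>. Every other pair of fibres is either a diagonal one compared
  with itself or two empty sets.\<close>

lemma card_joint_fibre_commute:
  fixes f g :: "'a \<Rightarrow> nat"
  assumes "finite S" and "\<And>x. x \<in> S \<Longrightarrow> f x \<le> 1" and "\<And>x. x \<in> S \<Longrightarrow> g x \<le> 1"
    and "sum f S = sum g S"
  shows "card {x \<in> S. f x = k \<and> g x = l} = card {x \<in> S. f x = l \<and> g x = k}"
proof -
  let ?N = "\<lambda>a b. {x \<in> S. f x = a \<and> g x = b}"
  have f: "sum f S = card (?N 1 0) + card (?N 1 1)"
  proof -
    have "f x = of_bool (f x = 1 \<and> g x = 0) + of_bool (f x = 1 \<and> g x = 1)" if "x \<in> S" for x
      using assms(2,3)[OF that] by (auto simp: le_Suc_eq)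
    then have "sum f S = (\<Sum>x\<in>S. of_bool (f x = 1 \<and> g x = 0) + of_bool (f x = 1 \<and> g x = 1))"
      by (rule sum.cong[OF refl])
    then show ?thesis
      using assms(1) by (simp add: sum.distrib sum_of_bool_eq Int_def)
  qed
  have g: "sum g S = card (?N 0 1) + card (?N 1 1)"
  proof -
    have "g x = of_bool (f x = 0 \<and> g x = 1) + of_bool (f x = 1 \<and> g x = 1)" if "x \<in> S" for x
      using assms(2,3)[OF that] by (auto simp: le_Suc_eq)
    then have "sum g S = (\<Sum>x\<in>S. of_bool (f x = 0 \<and> g x = 1) + of_bool (f x = 1 \<and> g x = 1))"
      by (rule sum.cong[OF refl])
    then show ?thesis
      using assms(1) by (simp add: sum.distrib sum_of_bool_eq Int_def)
  qed
  have eq: "card (?N 1 0) = card (?N 0 1)"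
    using f g assms(4) by linarith
  consider "k = l" | "k = 1" "l = 0" | "k = 0" "l = 1" | "k > 1 \<or> l > 1"
    by linarith
  then show ?thesis
  proof cases
    case 4
    then have "?N k l = {}" "?N l k = {}"
      using assms(2,3) by force+
    then show ?thesis by (simp only:)
  qed (use eq in auto)
qed

section \<open>Permutations and the exchange of two entries\<close>

lemma finite_Sn: "finite (Sn n)"
  by (simp add: Sn_def)

lemma Sn_iff_mset: "\<pi> \<in> Sn n \<longleftrightarrow> mset \<pi> = mset_set {1..n}"
  by (simp add: Sn_def permutations_of_set_altdef permutations_of_multiset_def)

lemma length_Sn: "\<pi> \<in> Sn n \<Longrightarrow> length \<pi> = n"
  by (metis Sn_iff_mset card_atLeastAtMost diff_Suc_1 size_mset size_mset_set)

lemma entry_Sn: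
  assumes "\<pi> \<in> Sn n" and "m \<in> {1..n}"
  shows "entry \<pi> m \<in> {1..n}"
proof -
  have "set \<pi> = {1..n}"
    using assms(1) by (simp add: Sn_def permutations_of_set_def)
  then show ?thesis
    using assms length_Sn[OF assms(1)] nth_mem[of "m - 1" \<pi>] by (auto simp: entry_def)
qed

lemma inj_on_entry_Sn:
  assumes "\<pi> \<in> Sn n"
  shows "inj_on (entry \<pi>) {1..n}"
proof (rule inj_onI)
  fix x y assume "x \<in> {1..n}" "y \<in> {1..n}" "entry \<pi> x = entry \<pi> y"
  moreover have "distinct \<pi>"
    using assms by (simp add: Sn_def permutations_of_set_def)
  ultimately show "x = y"
    using length_Sn[OF assms] by (auto simp: entry_def nth_eq_iff_index_eq)
qed

text \<open>Positions are one-based, hence the shift by 1 in the list updates. Both new values are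
  read from the original \<open>\<pi>\<close>.\<close>

definition swap_entries :: "nat \<Rightarrow> nat \<Rightarrow> nat list \<Rightarrow> nat list" where
  "swap_entries j k \<pi> = \<pi>[j - 1 := entry \<pi> k, k - 1 := entry \<pi> j]"

lemma length_swap_entries [simp]: "length (swap_entries j k \<pi>) = length \<pi>"
  by (simp add: swap_entries_def)

lemma entry_swap_entries:
  assumes "j \<in> {1..length \<pi>}" "k \<in> {1..length \<pi>}" "m \<in> {1..length \<pi>}"
  shows "entry (swap_entries j k \<pi>) m =
    (if m = k then entry \<pi> j else if m = j then entry \<pi> k else entry \<pi> m)"
  using assms by (auto simp: swap_entries_def entry_def nth_list_update)

lemma swap_entries_involutive:
  assumes "j \<in> {1..length \<pi>}" "k \<in> {1..length \<pi>}"
  shows "swap_entries j k (swap_entries j k \<pi>) = \<pi>"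
proof (rule nth_equalityI)
  fix m assume "m < length (swap_entries j k (swap_entries j k \<pi>))"
  then have "entry (swap_entries j k (swap_entries j k \<pi>)) (Suc m) = entry \<pi> (Suc m)"
    using assms by (simp add: entry_swap_entries)
  then show "swap_entries j k (swap_entries j k \<pi>) ! m = \<pi> ! m"
    by (simp add: entry_def)
qed simp

lemma swap_entries_in_Sn:
  assumes "\<pi> \<in> Sn n" "j \<in> {1..n}" "k \<in> {1..n}"
  shows "swap_entries j k \<pi> \<in> Sn n"
  using assms length_Sn[OF assms(1)]
  by (auto simp: Sn_iff_mset swap_entries_def entry_def mset_swap)

section \<open>Occurrences in terms of grid lines\<close>

text \<open>Positions and values enter as the same two lists of grid lines for both patterns; only the
  order condition on the three entries differs.\<close>

definition avoids_boxes ::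
    "(nat \<times> nat) set \<Rightarrow> nat list \<Rightarrow> nat \<Rightarrow> nat \<Rightarrow> nat \<Rightarrow> nat \<Rightarrow> nat \<Rightarrow> nat \<Rightarrow> bool" where
  "avoids_boxes R \<pi> i j k u v w \<longleftrightarrow>
    (\<forall>(a, b) \<in> R. \<forall>m \<in> {1..length \<pi>}.
      \<not> ([0, i, j, k, length \<pi> + 1] ! a < m \<and> m < [0, i, j, k, length \<pi> + 1] ! (a + 1) \<and>
         [0, u, v, w, length \<pi> + 1] ! b < entry \<pi> m \<and>
         entry \<pi> m < [0, u, v, w, length \<pi> + 1] ! (b + 1)))"

lemma order_isomorphic_123:
  "order_isomorphic [x, y, z] [1, 2, 3] \<longleftrightarrow> x < y \<and> y < z"
  by (auto simp: order_isomorphic_def All_less_Suc numeral_3_eq_3)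

lemma order_isomorphic_132:
  "order_isomorphic [x, y, z] [1, 3, 2] \<longleftrightarrow> x < z \<and> z < y"
  by (auto simp: order_isomorphic_def All_less_Suc numeral_3_eq_3)

lemma is_occurrence_length:
  "is_occurrence (\<tau>, R) \<pi> ps \<Longrightarrow> length ps = length \<tau>"
  by (simp add: is_occurrence_def order_isomorphic_def Let_def)

text \<open>The case split is on the order condition: if it holds, the sorted list of entries is
  known explicitly; if it fails, both sides are false.\<close>

lemma is_occurrence_123:
  "is_occurrence ([1, 2, 3], R) \<pi> [i, j, k] \<longleftrightarrow>
    1 \<le> i \<and> i < j \<and> j < k \<and> k \<le> length \<pi> \<and> entry \<pi> i < entry \<pi> j \<and> entry \<pi> j < entry \<pi> k \<and>
    avoids_boxes R \<pi> i j k (entry \<pi> i) (entry \<pi> j) (entry \<pi> k)"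
proof (cases "entry \<pi> i < entry \<pi> j \<and> entry \<pi> j < entry \<pi> k")
  case True
  then have "sort [entry \<pi> i, entry \<pi> j, entry \<pi> k] = [entry \<pi> i, entry \<pi> j, entry \<pi> k]"
    by (intro sort_key_id_if_sorted) simp
  then show ?thesis
    using True unfolding is_occurrence_def Let_def bd_def avoids_boxes_def prod.case
    by (auto simp: order_isomorphic_123[unfolded One_nat_def])
next
  case False
  then show ?thesis
    by (auto simp: is_occurrence_def order_isomorphic_123[unfolded One_nat_def] Let_def)
qed

lemma is_occurrence_132:
  "is_occurrence ([1, 3, 2], R) \<pi> [i, j, k] \<longleftrightarrow>
    1 \<le> i \<and> i < j \<and> j < k \<and> k \<le> length \<pi> \<and> entry \<pi> i < entry \<pi> k \<and> entry \<pi> k < entry \<pi> j \<and>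
    avoids_boxes R \<pi> i j k (entry \<pi> i) (entry \<pi> k) (entry \<pi> j)"
proof (cases "entry \<pi> i < entry \<pi> k \<and> entry \<pi> k < entry \<pi> j")
  case True
  then have "sort [entry \<pi> i, entry \<pi> j, entry \<pi> k] = [entry \<pi> i, entry \<pi> k, entry \<pi> j]"
    by simp
  then show ?thesis
    using True unfolding is_occurrence_def Let_def bd_def avoids_boxes_def prod.case
    by (auto simp: order_isomorphic_132[unfolded One_nat_def])
next
  case False
  then show ?thesis
    by (auto simp: is_occurrence_def order_isomorphic_132[unfolded One_nat_def] Let_def)
qed

section \<open>The exchange as a bijection on occurrences\<close>

text \<open>A point in the interior of a column lies on no vertical grid line, so its position is
  neither \<open>j\<close> nor \<open>k\<close> and the exchange leaves it alone. The horizontal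
  lines \<open>u\<close>, \<open>v\<close>, \<open>w\<close> are fixed parameters.\<close>

lemma avoids_boxes_swap_entries:
  assumes R: "R \<subseteq> {0..3} \<times> {0..3}" and pos: "1 \<le> i" "i < j" "j < k" "k \<le> length \<pi>"
  shows "avoids_boxes R (swap_entries j k \<pi>) i j k u v w \<longleftrightarrow> avoids_boxes R \<pi> i j k u v w"
proof -
  have "entry (swap_entries j k \<pi>) m = entry \<pi> m"
    if "(a, b) \<in> R" "m \<in> {1..length \<pi>}" "[0, i, j, k, length \<pi> + 1] ! a < m"
      "m < [0, i, j, k, length \<pi> + 1] ! (a + 1)" for a b m
  proof -
    have "a \<in> {0, 1, 2, 3}"
      using R that(1) by force
    then have "m \<noteq> j \<and> m \<noteq> k"
      using that(3,4) pos by auto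
    then show ?thesis
      using that(2) pos by (simp add: entry_swap_entries)
  qed
  then show ?thesis
    unfolding avoids_boxes_def length_swap_entries by (smt (verit) case_prodD case_prodI2)
qed

text \<open>After the exchange, the entries at \<open>i\<close>, \<open>k\<close>, \<open>j\<close>
  are the former entries at \<open>i\<close>, \<open>j\<close>, \<open>k\<close>. Thus the order
  condition for 132 becomes the one for 123, with the same horizontal grid lines in the same
  order.\<close>

lemma is_occurrence_swap_entries:
  assumes "R \<subseteq> {0..3} \<times> {0..3}" and "1 \<le> i" "i < j" "j < k" "k \<le> length \<pi>"
  shows "is_occurrence ([1, 3, 2], R) (swap_entries j k \<pi>) [i, j, k] \<longleftrightarrow>
    is_occurrence ([1, 2, 3], R) \<pi> [i, j, k]"
  using assms
  by (simp add: is_occurrence_123[unfolded One_nat_def] is_occurrence_132[unfolded One_nat_def]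
      avoids_boxes_swap_entries entry_swap_entries)

text \<open>Each sum counts pairs of a permutation and an occurrence in it. The exchange keeps the
  positions, so a pair still records which two entries to exchange back.\<close>

lemma sum_occurrences_123_132:
  assumes R: "R \<subseteq> {0..3} \<times> {0..3}"
  shows "(\<Sum>\<pi>\<in>Sn n. occurrences ([1, 2, 3], R) \<pi>) = (\<Sum>\<pi>\<in>Sn n. occurrences ([1, 3, 2], R) \<pi>)"
proof -
  let ?O = "\<lambda>\<tau>. SIGMA \<pi>:Sn n. {ps. is_occurrence (\<tau>, R) \<pi> ps}"
  \<comment> \<open>\<open>ps ! 1\<close> and \<open>ps ! 2\<close> are the second and third
    positions \<open>j\<close> and \<open>k\<close>.\<close>
  let ?F = "\<lambda>(\<pi>, ps). (swap_entries (ps ! 1) (ps ! 2) \<pi>, ps)"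
  have pos: "\<exists>i j k. ps = [i, j, k] \<and> 1 \<le> i \<and> i < j \<and> j < k \<and> k \<le> length \<pi> \<and> length \<pi> = n"
    if "(\<pi>, ps) \<in> ?O [1, 2, 3] \<or> (\<pi>, ps) \<in> ?O [1, 3, 2]" for \<pi> ps
  proof -
    have "length ps = 3"
      using that by (auto dest: is_occurrence_length)
    then obtain i j k where "ps = [i, j, k]"
      by (auto simp: numeral_3_eq_3 length_Suc_conv)
    then show ?thesis
      using that length_Sn
      by (auto simp: is_occurrence_123[unfolded One_nat_def] is_occurrence_132[unfolded One_nat_def])
  qed
  have invol: "?F (?F x) = x" if "x \<in> ?O [1, 2, 3] \<union> ?O [1, 3, 2]" for x
  proof (cases x)
    case (Pair \<pi> ps)
    then show ?thesis
      using that pos[of \<pi> ps] by (auto simp: swap_entries_involutive)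
  qed
  have F: "?F x \<in> ?O [1, 3, 2]" if x: "x \<in> ?O [1, 2, 3]" for x
  proof (cases x)
    case (Pair \<pi> ps)
    obtain i j k where ijk: "ps = [i, j, k]" "1 \<le> i" "i < j" "j < k" "k \<le> length \<pi>" "length \<pi> = n"
      using pos[of \<pi> ps] x Pair by auto
    then show ?thesis
      using x Pair is_occurrence_swap_entries[OF R ijk(2-5)] by (auto simp: swap_entries_in_Sn)
  qed
  have G: "?F x \<in> ?O [1, 2, 3]" if x: "x \<in> ?O [1, 3, 2]" for x
  proof (cases x)
    case (Pair \<pi> ps)
    obtain i j k where ijk: "ps = [i, j, k]" "1 \<le> i" "i < j" "j < k" "k \<le> length \<pi>" "length \<pi> = n"
      using pos[of \<pi> ps] x Pair by auto
    then show ?thesis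
      \<comment> \<open>The equivalence is applied to the exchanged permutation, whose own exchange
        is \<open>\<pi>\<close> again.\<close>
      using x Pair is_occurrence_swap_entries[OF R, of i j k "swap_entries j k \<pi>"]
      by (auto simp: swap_entries_in_Sn swap_entries_involutive)
  qed
  have "bij_betw ?F (?O [1, 2, 3]) (?O [1, 3, 2])"
    by (rule bij_betw_byWitness[where f' = ?F]) (use invol F G in blast)+
  then have "card (?O [1, 2, 3]) = card (?O [1, 3, 2])"
    by (rule bij_betw_same_card)
  then show ?thesis
    by (simp add: occurrences_def finite_Sn finite_occurrences)
qed

section \<open>Points and grid lines of a single occurrence\<close>

lemma occurrences_le_1I:
  assumes "length \<tau> = 3"
    and "\<And>i j k i' j' k'. is_occurrence (\<tau>, R) \<pi> [i, j, k] \<Longrightarrow>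
      is_occurrence (\<tau>, R) \<pi> [i', j', k'] \<Longrightarrow> i = i' \<and> j = j' \<and> k = k'"
  shows "occurrences (\<tau>, R) \<pi> \<le> 1"
proof -
  have "ps = qs" if occ: "is_occurrence (\<tau>, R) \<pi> ps" "is_occurrence (\<tau>, R) \<pi> qs" for ps qs
  proof -
    obtain i j k i' j' k' where "ps = [i, j, k]" "qs = [i', j', k']"
      using occ[THEN is_occurrence_length] assms(1)
      by (auto simp: numeral_3_eq_3 length_Suc_conv)
    then show ?thesis
      using assms(2) occ by blast
  qed
  then show ?thesis
    unfolding occurrences_def by (subst One_nat_def, subst card_le_Suc0_iff_eq) (auto simp: finite_occurrences)
qed

lemma avoids_boxesD:
  assumes "avoids_boxes R \<pi> i j k u v w" "(a, b) \<in> R" "m \<in> {1..length \<pi>}"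
    and "[0, i, j, k, length \<pi> + 1] ! a < m" "m < [0, i, j, k, length \<pi> + 1] ! (a + 1)"
    and "[0, u, v, w, length \<pi> + 1] ! b < entry \<pi> m"
  shows "[0, u, v, w, length \<pi> + 1] ! (b + 1) \<le> entry \<pi> m"
  using assms unfolding avoids_boxes_def by (metis (no_types, lifting) case_prodD not_less)

text \<open>The entries enter only through their sorted list \<open>u < v < w\<close>, so that 123 and 132 are
  instances of the same locale.\<close>

locale boxed_triple =
  fixes R \<pi> n i j k u v w
  assumes \<pi>: "\<pi> \<in> Sn n" and box: "avoids_boxes R \<pi> i j k u v w"
    and pos: "1 \<le> i" "i < j" "j < k" "k \<le> n"
    and vals: "u < v" "v < w" and entries: "{entry \<pi> i, entry \<pi> j, entry \<pi> k} = {u, v, w}"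
begin

text \<open>Since \<open>\<pi>\<close> is injective, a point on a horizontal grid line is one of the
  three points of the triple, and so lies on a vertical one too. Hence all other points are in the
  interior of boxes.\<close>

lemma entry_mem_iff:
  assumes "m \<in> {1..n}"
  shows "entry \<pi> m \<in> {u, v, w} \<longleftrightarrow> m \<in> {i, j, k}"
proof -
  have "{i, j, k} \<subseteq> {1..n}"
    using pos by auto
  then have "entry \<pi> m \<in> {entry \<pi> i, entry \<pi> j, entry \<pi> k} \<longleftrightarrow> m \<in> {i, j, k}"
    using inj_onD[OF inj_on_entry_Sn[OF \<pi>] _ assms] by blast
  then show ?thesis
    unfolding entries .
qed

text \<open>The hypothesis is on the value and the conclusion on the position, for use when the row
  of a point is known and its column is not; \<open>row_cases\<close> is the transposed
  version.\<close>

lemma column_cases: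
  assumes "m \<in> {1..n}" "entry \<pi> m \<notin> {u, v, w}"
  obtains "m < i" | "i < m" "m < j" | "j < m" "m < k" | "k < m"
  using assms entry_mem_iff[of m] by (metis insertI1 insertI2 linorder_neqE_nat)

lemma row_cases:
  assumes "m \<in> {1..n}" "m \<notin> {i, j, k}"
  obtains "entry \<pi> m < u" | "u < entry \<pi> m" "entry \<pi> m < v" |
    "v < entry \<pi> m" "entry \<pi> m < w" | "w < entry \<pi> m"
  using assms entry_mem_iff[of m] by (metis insertI1 insertI2 linorder_neqE_nat)

lemma box_bound:
  assumes "(a, b) \<in> R" "m \<in> {1..n}"
    and "[0, i, j, k, n + 1] ! a < m" "m < [0, i, j, k, n + 1] ! (a + 1)"
    and "[0, u, v, w, n + 1] ! b < entry \<pi> m"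
  shows "[0, u, v, w, n + 1] ! (b + 1) \<le> entry \<pi> m"
  using avoids_boxesD[OF box] assms length_Sn[OF \<pi>] by simp

end

lemma boxed_triple_123:
  assumes "\<pi> \<in> Sn n" "is_occurrence ([1, 2, 3], R) \<pi> [i, j, k]"
  shows "boxed_triple R \<pi> n i j k (entry \<pi> i) (entry \<pi> j) (entry \<pi> k)"
  using assms length_Sn[OF assms(1)] unfolding is_occurrence_123 by unfold_locales auto

lemma boxed_triple_132:
  assumes "\<pi> \<in> Sn n" "is_occurrence ([1, 3, 2], R) \<pi> [i, j, k]"
  shows "boxed_triple R \<pi> n i j k (entry \<pi> i) (entry \<pi> k) (entry \<pi> j)"
  using assms length_Sn[OF assms(1)] unfolding is_occurrence_132 by unfold_locales auto

section \<open>Regions emptied by the two shadings\<close>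

text \<open>The three claims come from the fully shaded top row, the fully shaded column between
  \<open>j\<close> and \<open>k\<close>, and the two lowest boxes of the leftmost column.\<close>

lemma boxed_triple_R1:
  assumes "boxed_triple R1 \<pi> n i j k u v w" and m: "m \<in> {1..n}"
  shows "entry \<pi> m \<le> w" and "j < m \<Longrightarrow> k \<le> m" and "m < i \<Longrightarrow> v < entry \<pi> m"
proof -
  interpret boxed_triple R1 \<pi> n i j k u v w
    by (fact assms(1))
  note box = box_bound[OF _ m]
  \<comment> \<open>All points lie strictly between the outer grid lines \<open>0\<close> and
    \<open>n + 1\<close>. In the top row \<open>box\<close> therefore yields the contradiction
    \<open>n + 1 \<le> entry \<pi> m\<close>.\<close>
  have range: "0 < entry \<pi> m" "entry \<pi> m < n + 1"
    using entry_Sn[OF \<pi> m] by auto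
  have R: "(0,0) \<in> R1" "(0,1) \<in> R1" "(0,3) \<in> R1" "(1,3) \<in> R1" "(2,0) \<in> R1" "(2,1) \<in> R1"
    "(2,2) \<in> R1" "(2,3) \<in> R1" "(3,3) \<in> R1"
    by (auto simp: R1_def)
  note boxes = R[THEN box, simplified]
  have m_pos: "0 < m" "m < n + 1"
    using m by auto
  show "entry \<pi> m \<le> w"
  proof (rule ccontr)
    assume "\<not> entry \<pi> m \<le> w"
    then have "w < entry \<pi> m" "entry \<pi> m \<notin> {u, v, w}"
      using vals by auto
    from m this(2) show False
      by (cases rule: column_cases) (use boxes range m_pos \<open>w < entry \<pi> m\<close> in auto)
  qed
  show "k \<le> m" if "j < m"
  proof (rule ccontr)
    assume "\<not> k \<le> m"
    then have "m < k" "m \<notin> {i, j, k}"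
      using that pos by auto
    from m this(2) show False
      by (cases rule: row_cases) (use boxes range m_pos \<open>m < k\<close> that in auto)
  qed
  show "v < entry \<pi> m" if "m < i"
  proof -
    have "m \<notin> {i, j, k}"
      using that pos by auto
    with m show ?thesis
      by (cases rule: row_cases) (use boxes range m_pos that vals in auto)
  qed
qed

text \<open>\<open>R2\<close> is the transpose of \<open>R1\<close>, so rows and columns trade
  roles: the rightmost column and the row between \<open>v\<close> and \<open>w\<close> are fully
  shaded, and so are the first two boxes of the bottom row.\<close>

lemma boxed_triple_R2:
  assumes "boxed_triple R2 \<pi> n i j k u v w" and m: "m \<in> {1..n}"
  shows "m \<le> k" and "v < entry \<pi> m \<Longrightarrow> w \<le> entry \<pi> m" and "m < j \<Longrightarrow> u \<le> entry \<pi> m"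
proof -
  interpret boxed_triple R2 \<pi> n i j k u v w
    by (fact assms(1))
  note box = box_bound[OF _ m]
  have range: "0 < entry \<pi> m" "entry \<pi> m < n + 1"
    using entry_Sn[OF \<pi> m] by auto
  have R: "(0,0) \<in> R2" "(1,0) \<in> R2" "(3,0) \<in> R2" "(3,1) \<in> R2" "(0,2) \<in> R2" "(1,2) \<in> R2"
    "(2,2) \<in> R2" "(3,2) \<in> R2" "(3,3) \<in> R2"
    by (auto simp: R2_def)
  note boxes = R[THEN box, simplified]
  have m_pos: "0 < m" "m < n + 1"
    using m by auto
  show "m \<le> k"
  proof (rule ccontr)
    assume "\<not> m \<le> k"
    then have "k < m" "m \<notin> {i, j, k}"
      using pos by auto
    from m this(2) show False
      by (cases rule: row_cases) (use boxes range m_pos \<open>k < m\<close> in auto)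
  qed
  show "w \<le> entry \<pi> m" if "v < entry \<pi> m"
  proof (rule ccontr)
    assume "\<not> w \<le> entry \<pi> m"
    then have "entry \<pi> m < w" "entry \<pi> m \<notin> {u, v, w}"
      using that vals by auto
    from m this(2) show False
      by (cases rule: column_cases) (use boxes range m_pos \<open>entry \<pi> m < w\<close> that in auto)
  qed
  show "u \<le> entry \<pi> m" if "m < j"
  proof (rule ccontr)
    assume "\<not> u \<le> entry \<pi> m"
    then have "entry \<pi> m < u" "entry \<pi> m \<notin> {u, v, w}"
      using vals by auto
    from m this(2) show False
      by (cases rule: column_cases) (use boxes range m_pos \<open>entry \<pi> m < u\<close> that pos in auto)
  qed
qed

section \<open>At most one occurrence\<close>

text \<open>The value \<open>w\<close> is the maximum of \<open>\<pi>\<close>, which fixes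
  \<open>k\<close> for 123 and \<open>j\<close> for 132. The positions \<open>j\<close> and
  \<open>k\<close> are adjacent, which fixes the other one and with it \<open>v\<close>. Finally
  \<open>i\<close> is the leftmost position with an entry below \<open>v\<close>.\<close>

lemma occurrences_R1_le_1:
  assumes \<pi>: "\<pi> \<in> Sn n"
  shows "occurrences ([1, 2, 3], R1) \<pi> \<le> 1" and "occurrences ([1, 3, 2], R1) \<pi> \<le> 1"
proof -
  note inj = inj_onD[OF inj_on_entry_Sn[OF \<pi>]]
  show "occurrences ([1, 2, 3], R1) \<pi> \<le> 1"
  proof (rule occurrences_le_1I)
    fix i j k i' j' k'
    assume occ: "is_occurrence ([1, 2, 3], R1) \<pi> [i, j, k]"
      and occ': "is_occurrence ([1, 2, 3], R1) \<pi> [i', j', k']"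
    note bt = boxed_triple_123[OF \<pi> occ] and bt' = boxed_triple_123[OF \<pi> occ']
    note p = boxed_triple.pos[OF bt] boxed_triple.pos[OF bt']
      and v = boxed_triple.vals[OF bt] boxed_triple.vals[OF bt']
      and l = boxed_triple_R1[OF bt] and l' = boxed_triple_R1[OF bt']
    have mem: "i \<in> {1..n}" "j \<in> {1..n}" "k \<in> {1..n}"
      and mem': "i' \<in> {1..n}" "j' \<in> {1..n}" "k' \<in> {1..n}"
      using p by auto
    have k: "k = k'"
    proof (rule inj[OF _ mem(3) mem'(3)])
      show "entry \<pi> k = entry \<pi> k'"
        by (intro antisym l(1)[OF mem'(3)] l'(1)[OF mem(3)])
    qed
    \<comment> \<open>If \<open>j < j'\<close>, then \<open>k \<le> j' < k' = k\<close>, and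
      symmetrically.\<close>
    have j: "j = j'"
      by (intro antisym leI notI) (use l(2)[OF mem'(2)] l'(2)[OF mem(2)] p k in auto)
    \<comment> \<open>If \<open>i' < i\<close>, then the entry at \<open>i'\<close> exceeds
      \<open>v\<close>; but it is below the middle value of its own triple, which is the same
      \<open>v\<close> because \<open>j = j'\<close>.\<close>
    have i: "i = i'"
      by (intro antisym leI notI) (use l(3)[OF mem'(1)] l'(3)[OF mem(1)] p v j in auto)
    from i j k show "i = i' \<and> j = j' \<and> k = k'"
      by blast
  qed simp
  show "occurrences ([1, 3, 2], R1) \<pi> \<le> 1"
  proof (rule occurrences_le_1I)
    fix i j k i' j' k'
    assume occ: "is_occurrence ([1, 3, 2], R1) \<pi> [i, j, k]"
      and occ': "is_occurrence ([1, 3, 2], R1) \<pi> [i', j', k']"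
    note bt = boxed_triple_132[OF \<pi> occ] and bt' = boxed_triple_132[OF \<pi> occ']
    note p = boxed_triple.pos[OF bt] boxed_triple.pos[OF bt']
      and v = boxed_triple.vals[OF bt] boxed_triple.vals[OF bt']
      and l = boxed_triple_R1[OF bt] and l' = boxed_triple_R1[OF bt']
    have mem: "i \<in> {1..n}" "j \<in> {1..n}" "k \<in> {1..n}"
      and mem': "i' \<in> {1..n}" "j' \<in> {1..n}" "k' \<in> {1..n}"
      using p by auto
    have j: "j = j'"
    proof (rule inj[OF _ mem(2) mem'(2)])
      show "entry \<pi> j = entry \<pi> j'"
        by (intro antisym l(1)[OF mem'(2)] l'(1)[OF mem(2)])
    qed
    have k: "k = k'"
      by (intro antisym leI notI) (use l(2)[OF mem'(3)] l'(2)[OF mem(3)] p j in auto)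
    have i: "i = i'"
      by (intro antisym leI notI) (use l(3)[OF mem'(1)] l'(3)[OF mem(1)] p v k in auto)
    from i j k show "i = i' \<and> j = j' \<and> k = k'"
      by blast
  qed simp
qed

text \<open>Here \<open>k\<close> is the last position. No entry lies strictly between
  \<open>v\<close> and \<open>w\<close>, so the entry at \<open>j\<close> is the next one below the
  entry at \<open>k\<close> for 123 and the next one above it for 132. Finally the entry at
  \<open>i\<close> is the smallest one to the left of \<open>j\<close>.\<close>

lemma occurrences_R2_le_1:
  assumes \<pi>: "\<pi> \<in> Sn n"
  shows "occurrences ([1, 2, 3], R2) \<pi> \<le> 1" and "occurrences ([1, 3, 2], R2) \<pi> \<le> 1"
proof -
  note inj = inj_onD[OF inj_on_entry_Sn[OF \<pi>]]
  show "occurrences ([1, 2, 3], R2) \<pi> \<le> 1"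
  proof (rule occurrences_le_1I)
    fix i j k i' j' k'
    assume occ: "is_occurrence ([1, 2, 3], R2) \<pi> [i, j, k]"
      and occ': "is_occurrence ([1, 2, 3], R2) \<pi> [i', j', k']"
    note bt = boxed_triple_123[OF \<pi> occ] and bt' = boxed_triple_123[OF \<pi> occ']
    note p = boxed_triple.pos[OF bt] boxed_triple.pos[OF bt']
      and v = boxed_triple.vals[OF bt] boxed_triple.vals[OF bt']
      and l = boxed_triple_R2[OF bt] and l' = boxed_triple_R2[OF bt']
    have mem: "i \<in> {1..n}" "j \<in> {1..n}" "k \<in> {1..n}"
      and mem': "i' \<in> {1..n}" "j' \<in> {1..n}" "k' \<in> {1..n}"
      using p by auto
    have k: "k = k'"
      by (intro antisym leI notI) (use l(1)[OF mem'(3)] l'(1)[OF mem(3)] p in auto)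
    \<comment> \<open>If the entry at \<open>j\<close> were below the one at \<open>j'\<close>, the
      latter would be at least the entry at \<open>k = k'\<close>, contradicting the order
      123.\<close>
    have "entry \<pi> j = entry \<pi> j'"
      by (intro antisym leI notI) (use l(2)[OF mem'(2)] l'(2)[OF mem(2)] v k in auto)
    then have j: "j = j'"
      using mem(2) mem'(2) by (rule inj)
    have i: "i = i'"
    proof (rule inj[OF _ mem(1) mem'(1)])
      show "entry \<pi> i = entry \<pi> i'"
        by (intro antisym l(3)[OF mem'(1)] l'(3)[OF mem(1)]) (use p j in auto)
    qed
    from i j k show "i = i' \<and> j = j' \<and> k = k'"
      by blast
  qed simp
  show "occurrences ([1, 3, 2], R2) \<pi> \<le> 1"
  proof (rule occurrences_le_1I)
    fix i j k i' j' k'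
    assume occ: "is_occurrence ([1, 3, 2], R2) \<pi> [i, j, k]"
      and occ': "is_occurrence ([1, 3, 2], R2) \<pi> [i', j', k']"
    note bt = boxed_triple_132[OF \<pi> occ] and bt' = boxed_triple_132[OF \<pi> occ']
    note p = boxed_triple.pos[OF bt] boxed_triple.pos[OF bt']
      and v = boxed_triple.vals[OF bt] boxed_triple.vals[OF bt']
      and l = boxed_triple_R2[OF bt] and l' = boxed_triple_R2[OF bt']
    have mem: "i \<in> {1..n}" "j \<in> {1..n}" "k \<in> {1..n}"
      and mem': "i' \<in> {1..n}" "j' \<in> {1..n}" "k' \<in> {1..n}"
      using p by auto
    have k: "k = k'"
      by (intro antisym leI notI) (use l(1)[OF mem'(3)] l'(1)[OF mem(3)] p in auto)
    have j: "j = j'"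
    proof (rule inj[OF _ mem(2) mem'(2)])
      show "entry \<pi> j = entry \<pi> j'"
        by (intro antisym l(2)[OF mem'(2)] l'(2)[OF mem(2)]) (use v k in auto)
    qed
    have i: "i = i'"
    proof (rule inj[OF _ mem(1) mem'(1)])
      show "entry \<pi> i = entry \<pi> i'"
        by (intro antisym l(3)[OF mem'(1)] l'(3)[OF mem(1)]) (use p j in auto)
    qed
    from i j k show "i = i' \<and> j = j' \<and> k = k'"
      by blast
  qed simp
qed

section \<open>Joint equidistribution\<close>

text \<open>Equality of the totals holds for every shading, so what remains to be checked for
  \<open>R1\<close> and \<open>R2\<close> is that each pattern occurs at most once.\<close>

lemma jointly_equidistributed_123_132:
  assumes "R \<subseteq> {0..3} \<times> {0..3}"
    and "\<And>n \<pi>. \<pi> \<in> Sn n \<Longrightarrow> occurrences ([1, 2, 3], R) \<pi> \<le> 1"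
    and "\<And>n \<pi>. \<pi> \<in> Sn n \<Longrightarrow> occurrences ([1, 3, 2], R) \<pi> \<le> 1"
  shows "([1, 2, 3], R) \<sim>jd ([1, 3, 2], R)"
  unfolding jointly_equidistributed_def
  by (intro allI card_joint_fibre_commute finite_Sn assms sum_occurrences_123_132)

theorem theorem4p1:
  shows "([1,2,3], R1) \<sim>jd ([1,3,2], R1) \<and> ([1,2,3], R2) \<sim>jd ([1,3,2], R2)"
proof
  show "([1,2,3], R1) \<sim>jd ([1,3,2], R1)"
    by (rule jointly_equidistributed_123_132) (use occurrences_R1_le_1 in \<open>auto simp: R1_def\<close>)
  show "([1,2,3], R2) \<sim>jd ([1,3,2], R2)"
    by (rule jointly_equidistributed_123_132) (use occurrences_R2_le_1 in \<open>auto simp: R2_def\<close>)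
qed

end
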